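(* Consider a static axisymmetric vacuum spacetime of Weyl's class, with smooth $\lambda,\mu$ on a connected open subset of the half-plane $\{\rho>0\}$. Let $q\in\{0,-1\}$ and let $K$ be a rank-2 Killing tensor of the canonical form $$K=\lambda_0(\theta^1\otimes\theta^1+q\,\theta^2\otimes\theta^2)+\lambda_1(\theta^1\otimes\theta^2+\theta^2\otimes\theta^1)+\lambda_2(\theta^3\otimes\theta^4+\theta^4\otimes\theta^3)+\lambda_3(\theta^3\otimes\theta^3+\theta^4\otimes\theta^4),$$ where $\lambda_0,\lambda_1,\lambda_2,\lambda_3$ are smooth real functions of $(\rho,z)$. Then $K$ is reducible.
   Context: A static axisymmetric vacuum metric of Weyl's class is, in coordinates $(t,\phi,\rho,z)$ with $\rho>0$, $ds^2=e^{2\lambda}dt^2-e^{-2\lambda}[\rho^2d\phi^2+e^{2\mu}(d\rho^2+dz^2)]$, where $\lambda,\mu$ are real functions of $(\rho,z)$ satisfying $\lambda_{\rho\rho}+\lambda_\rho/\rho+\lambda_{zz}=0$, $\mu_\rho=\rho(\lambda_\rho^2-\lambda_z^2)$, $\mu_z=2\rho\lambda_\rho\lambda_z$. The function $\lambda$ in the metric is distinct from the scalars $\lambda_0,\dots,\lambda_3$. Null coframe: $\theta^1=\frac{1}{\sqrt2}(e^{\lambda}dt+\rho e^{-\lambda}d\phi)$, $\theta^2=\frac1{\sqrt2}(e^{\lambda}dt-\rho e^{-\lambda}d\phi)$, $\theta^3=-\frac{e^{\mu-\lambda}}{\sqrt2}(d\rho-i\,dz)$, $\theta^4=-\frac{e^{\mu-\lambda}}{\sqrt2}(d\rho+i\,dz)$,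 so that $ds^2=2(\theta^1\theta^2-\theta^3\theta^4)$. A rank-2 Killing tensor is a symmetric tensor $K_{\mu\nu}$ with $\nabla_{(\alpha}K_{\mu\nu)}=0$. It is called reducible if it is a linear combination, with constant coefficients, of the metric and symmetrized products of Killing vector fields of the spacetime. *)

theory Defs
  imports "HOL-Analysis.Analysis"
begin

section \<open>Smooth functions on open subsets of coordinate space\<close>

definition pd :: "'n::finite \<Rightarrow> (real ^ 'n \<Rightarrow> real) \<Rightarrow> real ^ 'n \<Rightarrow> real" where
  "pd i f x = frechet_derivative f (at x) (axis i 1)"

text \<open>Only meant for open sets: the derivatives are taken at \<open>x\<close>, not within \<open>S\<close>.\<close>

fun Ck_on :: "nat \<Rightarrow> (real ^ 'n::finite) set \<Rightarrow> (real ^ 'n \<Rightarrow> real) \<Rightarrow> bool" where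
  "Ck_on 0 S f \<longleftrightarrow> continuous_on S f"
| "Ck_on (Suc k) S f \<longleftrightarrow> (\<forall>x\<in>S. f differentiable (at x)) \<and> (\<forall>i. Ck_on k S (pd i f))"

definition smooth_on :: "(real ^ 'n::finite) set \<Rightarrow> (real ^ 'n \<Rightarrow> real) \<Rightarrow> bool" where
  "smooth_on S f \<longleftrightarrow> (\<forall>k. Ck_on k S f)"

section \<open>Killing tensors in a coordinate patch\<close>

text \<open>
  A metric, or any covariant tensor field of rank 2, is given by its components
  \<open>T x $ i $ j\<close> in a global chart; vector fields by contravariant and one-forms by
  covariant components.
\<close>

type_synonym 'n tensor2 = "real ^ 'n \<Rightarrow> real ^ 'n ^ 'n"
type_synonym 'n vfield = "real ^ 'n \<Rightarrow> real ^ 'n"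

text \<open>\<open>christoffel g x k i j\<close> is \<open>\<Gamma>\<close> with upper index \<open>k\<close> and lower indices \<open>i j\<close>.\<close>

definition christoffel :: "('n::finite) tensor2 \<Rightarrow> real ^ 'n \<Rightarrow> 'n \<Rightarrow> 'n \<Rightarrow> 'n \<Rightarrow> real" where
  "christoffel g x k i j =
     (\<Sum>l\<in>UNIV. matrix_inv (g x) $ k $ l *
        (pd i (\<lambda>y. g y $ j $ l) x + pd j (\<lambda>y. g y $ i $ l) x - pd l (\<lambda>y. g y $ i $ j) x)) / 2"

text \<open>In \<open>nabla1\<close> and \<open>nabla2\<close> the first index \<open>a\<close> is the direction of differentiation.\<close>

definition nabla1 :: "('n::finite) tensor2 \<Rightarrow> 'n vfield \<Rightarrow> real ^ 'n \<Rightarrow> 'n \<Rightarrow> 'n \<Rightarrow> real" where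
  "nabla1 g \<omega> x a m =
     pd a (\<lambda>y. \<omega> y $ m) x - (\<Sum>l\<in>UNIV. christoffel g x l a m * \<omega> x $ l)"

definition nabla2 :: "('n::finite) tensor2 \<Rightarrow> 'n tensor2 \<Rightarrow> real ^ 'n \<Rightarrow> 'n \<Rightarrow> 'n \<Rightarrow> 'n \<Rightarrow> real" where
  "nabla2 g K x a m n =
     pd a (\<lambda>y. K y $ m $ n) x
       - (\<Sum>l\<in>UNIV. christoffel g x l a m * K x $ l $ n)
       - (\<Sum>l\<in>UNIV. christoffel g x l a n * K x $ m $ l)"

definition lower :: "('n::finite) tensor2 \<Rightarrow> 'n vfield \<Rightarrow> 'n vfield" where
  "lower g \<xi> x = g x *v \<xi> x"

definition killing_field :: "('n::finite) tensor2 \<Rightarrow> (real ^ 'n) set \<Rightarrow> 'n vfield \<Rightarrow> bool" where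
  "killing_field g M \<xi> \<longleftrightarrow>
     (\<forall>i. smooth_on M (\<lambda>x. \<xi> x $ i)) \<and>
     (\<forall>x\<in>M. \<forall>a b. nabla1 g (lower g \<xi>) x a b + nabla1 g (lower g \<xi>) x b a = 0)"

definition killing_tensor :: "('n::finite) tensor2 \<Rightarrow> (real ^ 'n) set \<Rightarrow> 'n tensor2 \<Rightarrow> bool" where
  "killing_tensor g M K \<longleftrightarrow>
     (\<forall>i j. smooth_on M (\<lambda>x. K x $ i $ j)) \<and>
     (\<forall>x\<in>M. \<forall>i j. K x $ i $ j = K x $ j $ i) \<and>
     (\<forall>x\<in>M. \<forall>a m n.
        (nabla2 g K x a m n + nabla2 g K x a n m + nabla2 g K x m a n
         + nabla2 g K x m n a + nabla2 g K x n a m + nabla2 g K x n m a) / 6 = 0)"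

definition tprod :: "'a::times ^ 'n \<Rightarrow> 'a ^ 'n \<Rightarrow> 'a ^ 'n ^ 'n"  (infixr "\<otimes>\<^sub>t" 72) where
  "a \<otimes>\<^sub>t b = (\<chi> i j. a $ i * b $ j)"

definition sym_prod :: "('n::finite) tensor2 \<Rightarrow> 'n vfield \<Rightarrow> 'n vfield \<Rightarrow> 'n tensor2" where
  "sym_prod g \<xi> \<eta> x =
     (1/2) *\<^sub>R (lower g \<xi> x \<otimes>\<^sub>t lower g \<eta> x + lower g \<eta> x \<otimes>\<^sub>t lower g \<xi> x)"

definition reducible :: "('n::finite) tensor2 \<Rightarrow> (real ^ 'n) set \<Rightarrow> 'n tensor2 \<Rightarrow> bool" where
  "reducible g M K \<longleftrightarrow>
     (\<exists>(c0::real) (N::nat) (c::nat \<Rightarrow> real) (\<xi>::nat \<Rightarrow> 'n vfield) (\<eta>::nat \<Rightarrow> 'n vfield).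
        (\<forall>k<N. killing_field g M (\<xi> k) \<and> killing_field g M (\<eta> k)) \<and>
        (\<forall>x\<in>M. K x = c0 *\<^sub>R g x + (\<Sum>k<N. c k *\<^sub>R sym_prod g (\<xi> k) (\<eta> k) x)))"

section \<open>Weyl's class\<close>

text \<open>
  Points of the half-plane are \<open>p :: real ^ 2\<close> with \<open>p $ 1 = \<rho>\<close>, \<open>p $ 2 = z\<close>; spacetime points
  are \<open>x :: real ^ 4\<close> with coordinates \<open>(t, \<phi>, \<rho>, z)\<close> in this order.
\<close>

definition rz :: "real ^ 4 \<Rightarrow> real ^ 2" where
  "rz x = vector [x $ 3, x $ 4]"

text \<open>The chart \<open>\<real> \<times> \<real> \<times> U\<close>; the coordinate \<open>\<phi>\<close> is not identified modulo \<open>2\<pi>\<close>.\<close>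

definition spacetime :: "(real ^ 2) set \<Rightarrow> (real ^ 4) set" where
  "spacetime U = {x. rz x \<in> U}"

abbreviation dt :: "'a::zero_neq_one ^ 4" where "dt \<equiv> axis 1 1"
abbreviation dphi :: "'a::zero_neq_one ^ 4" where "dphi \<equiv> axis 2 1"
abbreviation drho :: "'a::zero_neq_one ^ 4" where "drho \<equiv> axis 3 1"
abbreviation dz :: "'a::zero_neq_one ^ 4" where "dz \<equiv> axis 4 1"

definition weyl_metric :: "(real ^ 2 \<Rightarrow> real) \<Rightarrow> (real ^ 2 \<Rightarrow> real) \<Rightarrow> 4 tensor2" where
  "weyl_metric lam mu x =
     exp (2 * lam (rz x)) *\<^sub>R (dt \<otimes>\<^sub>t dt)
       - exp (- 2 * lam (rz x)) *\<^sub>R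
           ((x $ 3)\<^sup>2 *\<^sub>R (dphi \<otimes>\<^sub>t dphi)
            + exp (2 * mu (rz x)) *\<^sub>R (drho \<otimes>\<^sub>t drho + dz \<otimes>\<^sub>t dz))"

definition weyl_vacuum :: "(real ^ 2) set \<Rightarrow> (real ^ 2 \<Rightarrow> real) \<Rightarrow> (real ^ 2 \<Rightarrow> real) \<Rightarrow> bool" where
  "weyl_vacuum U lam mu \<longleftrightarrow>
     open U \<and> connected U \<and> U \<subseteq> {p. p $ 1 > 0} \<and> smooth_on U lam \<and> smooth_on U mu \<and>
     (\<forall>p\<in>U. pd 1 (pd 1 lam) p + pd 1 lam p / p $ 1 + pd 2 (pd 2 lam) p = 0 \<and>
            pd 1 mu p = p $ 1 * ((pd 1 lam p)\<^sup>2 - (pd 2 lam p)\<^sup>2) \<and>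
            pd 2 mu p = 2 * p $ 1 * pd 1 lam p * pd 2 lam p)"

definition theta1 :: "(real ^ 2 \<Rightarrow> real) \<Rightarrow> real ^ 4 \<Rightarrow> complex ^ 4" where
  "theta1 lam x =
     (1 / sqrt 2) *\<^sub>R (exp (lam (rz x)) *\<^sub>R dt + (x $ 3 * exp (- lam (rz x))) *\<^sub>R dphi)"

definition theta2 :: "(real ^ 2 \<Rightarrow> real) \<Rightarrow> real ^ 4 \<Rightarrow> complex ^ 4" where
  "theta2 lam x =
     (1 / sqrt 2) *\<^sub>R (exp (lam (rz x)) *\<^sub>R dt - (x $ 3 * exp (- lam (rz x))) *\<^sub>R dphi)"

definition theta3 :: "(real ^ 2 \<Rightarrow> real) \<Rightarrow> (real ^ 2 \<Rightarrow> real) \<Rightarrow> real ^ 4 \<Rightarrow> complex ^ 4" where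
  "theta3 lam mu x = - (exp (mu (rz x) - lam (rz x)) / sqrt 2) *\<^sub>R (drho - \<i> *s dz)"

definition theta4 :: "(real ^ 2 \<Rightarrow> real) \<Rightarrow> (real ^ 2 \<Rightarrow> real) \<Rightarrow> real ^ 4 \<Rightarrow> complex ^ 4" where
  "theta4 lam mu x = - (exp (mu (rz x) - lam (rz x)) / sqrt 2) *\<^sub>R (drho + \<i> *s dz)"

definition complexify :: "real ^ 'n ^ 'n \<Rightarrow> complex ^ 'n ^ 'n" where
  "complexify A = (\<chi> i j. complex_of_real (A $ i $ j))"

lemma weyl_metric_coframe:
  "complexify (weyl_metric lam mu x) =
     (theta1 lam x \<otimes>\<^sub>t theta2 lam x + theta2 lam x \<otimes>\<^sub>t theta1 lam x)
       - (theta3 lam mu x \<otimes>\<^sub>t theta4 lam mu x + theta4 lam mu x \<otimes>\<^sub>t theta3 lam mu x)"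
proof -
  have e: "exp (2 * a) = exp a * exp a" "exp (- (2 * a)) = exp (- a) * exp (- a)"
    "exp (a - b) = exp a * exp (- b)" for a b :: real
    by (simp_all flip: exp_add)
  have s: "complex_of_real (sqrt 2) * complex_of_real (sqrt 2) = 2"
    by (simp flip: of_real_mult)
  show ?thesis
    unfolding vec_eq_iff forall_4 complexify_def tprod_def weyl_metric_def
      theta1_def theta2_def theta3_def theta4_def
    by (simp add: axis_def e s scaleR_conv_of_real[where 'a = complex] power2_eq_square
        divide_simps)
qed

definition canonical_form ::
  "(real ^ 2 \<Rightarrow> real) \<Rightarrow> (real ^ 2 \<Rightarrow> real) \<Rightarrow> real \<Rightarrow>
   (real ^ 2 \<Rightarrow> real) \<Rightarrow> (real ^ 2 \<Rightarrow> real) \<Rightarrow> (real ^ 2 \<Rightarrow> real) \<Rightarrow> (real ^ 2 \<Rightarrow> real) \<Rightarrow>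
   real ^ 4 \<Rightarrow> complex ^ 4 ^ 4" where
  "canonical_form lam mu q l0 l1 l2 l3 x =
     (let \<theta>1 = theta1 lam x; \<theta>2 = theta2 lam x; \<theta>3 = theta3 lam mu x; \<theta>4 = theta4 lam mu x in
        l0 (rz x) *\<^sub>R (\<theta>1 \<otimes>\<^sub>t \<theta>1 + q *\<^sub>R (\<theta>2 \<otimes>\<^sub>t \<theta>2))
        + l1 (rz x) *\<^sub>R (\<theta>1 \<otimes>\<^sub>t \<theta>2 + \<theta>2 \<otimes>\<^sub>t \<theta>1)
        + l2 (rz x) *\<^sub>R (\<theta>3 \<otimes>\<^sub>t \<theta>4 + \<theta>4 \<otimes>\<^sub>t \<theta>3)
        + l3 (rz x) *\<^sub>R (\<theta>3 \<otimes>\<^sub>t \<theta>3 + \<theta>4 \<otimes>\<^sub>t \<theta>4))"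

end

theory Submission
  imports Defs
begin

text \<open>
  Put \<open>D = l2 + l3\<close>, \<open>E = l2 - l3\<close>, \<open>s = l0 (1 + q) / 2\<close> and \<open>F = exp (2 mu - 2 lam)\<close>. Since \<open>q \<noteq> 1\<close>,
  the Killing equation makes \<open>l0 / \<rho>\<close> and \<open>(E - D) / F\<close> constant, and the equations for the
  \<open>t t\<close> and \<open>\<phi> \<phi>\<close> components combine to \<open>(l1 + E) lam\<^sub>z = 0\<close> and \<open>(l1 + D) (2 \<rho> lam\<^sub>\<rho> - 1) = 0\<close>.
  Where \<open>l3\<close> and \<open>lam\<^sub>z\<close> are both nonzero this forces \<open>l1 = - E\<close>, \<open>lam\<^sub>\<rho> = 1 / (2 \<rho>)\<close>, \<open>s = 0\<close>
  and \<open>mu\<^sub>\<rho> = 1 / \<rho>\<close>, contradicting \<open>mu\<^sub>\<rho> = \<rho> (lam\<^sub>\<rho>\<^sup>2 - lam\<^sub>z\<^sup>2) \<le> 1 / (4 \<rho>)\<close>. So either \<open>l3\<close> vanishes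
  identically or the metric does not depend on \<open>z\<close>. In both cases \<open>D\<close> is constant, and \<open>K + D g\<close> has
  constant coefficients in the products of \<open>\<partial>\<^sub>t\<close>, \<open>\<partial>\<^sub>\<phi>\<close> and, in the second case, \<open>\<partial>\<^sub>z\<close>.
\<close>

section \<open>Partial derivatives\<close>

lemma pd_has_derivative: "(f has_derivative f') (at x) \<Longrightarrow> pd i f x = f' (axis i 1)"
  by (simp add: pd_def frechet_derivative_at[symmetric])

lemma differentiable_has_derivative:
  "f differentiable (at x) \<Longrightarrow> (f has_derivative frechet_derivative f (at x)) (at x)"
  by (simp add: frechet_derivative_works)

lemma pd_const: "pd i (\<lambda>_. c) x = 0"
  by (simp add: pd_has_derivative[OF has_derivative_const])

lemma pd_minus:
  assumes "f differentiable (at x)"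
  shows "pd i (\<lambda>y. - f y) x = - pd i f x"
  by (subst pd_has_derivative[OF has_derivative_minus[OF differentiable_has_derivative[OF assms]]])
    (simp add: pd_def)

lemma pd_add:
  assumes "f differentiable (at x)" "g differentiable (at x)"
  shows "pd i (\<lambda>y. f y + g y) x = pd i f x + pd i g x"
  by (subst pd_has_derivative[OF has_derivative_add[OF assms[THEN differentiable_has_derivative]]])
    (simp add: pd_def)

lemma pd_diff:
  assumes "f differentiable (at x)" "g differentiable (at x)"
  shows "pd i (\<lambda>y. f y - g y) x = pd i f x - pd i g x"
  by (subst pd_has_derivative[OF has_derivative_diff[OF assms[THEN differentiable_has_derivative]]])
    (simp add: pd_def)

lemma pd_mult:
  assumes "f differentiable (at x)" "g differentiable (at x)"
  shows "pd i (\<lambda>y. f y * g y) x = f x * pd i g x + pd i f x * g x"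
  by (subst pd_has_derivative[OF has_derivative_mult[OF assms[THEN differentiable_has_derivative]]])
    (simp add: pd_def)

lemma pd_exp:
  assumes "f differentiable (at x)"
  shows "pd i (\<lambda>y. exp (f y)) x = exp (f x) * pd i f x"
  by (subst pd_has_derivative[OF has_derivative_exp[OF differentiable_has_derivative[OF assms]]])
    (simp add: pd_def)

lemma pd_inverse:
  assumes "f differentiable (at x)" "f x \<noteq> 0"
  shows "pd i (\<lambda>y. inverse (f y)) x = - pd i f x * (inverse (f x))\<^sup>2"
  by (subst pd_has_derivative[OF Deriv.has_derivative_inverse[OF assms(2) differentiable_has_derivative[OF assms(1)]]])
    (simp add: pd_def power2_eq_square)

lemma exp_differentiable:
  fixes f :: "real ^ 'n::finite \<Rightarrow> real"
  assumes "f differentiable (at x)"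
  shows "(\<lambda>y. exp (f y)) differentiable (at x)"
  using has_derivative_exp[OF differentiable_has_derivative[OF assms]]
  unfolding differentiable_def by blast

lemma nth_differentiable: "(\<lambda>y :: real ^ 'n::finite. y $ j) differentiable (at x)"
  by (intro linear_imp_differentiable bounded_linear.linear bounded_linear_vec_nth)

lemma pd_nth: "pd i (\<lambda>y :: real ^ 'n::finite. y $ j) x = (if i = j then 1 else 0)"
  by (simp add: pd_has_derivative[OF bounded_linear.has_derivative[OF bounded_linear_vec_nth has_derivative_ident]]
      axis_def)

text \<open>Functions that agree near \<open>x\<close> have the same candidates for a derivative
  there, so the choice inside \<open>frechet_derivative\<close> is the same. This lets an identity
  known on an open set be differentiated.\<close>

lemma pd_cong_open:
  assumes "open S" "x \<in> S" "\<And>y. y \<in> S \<Longrightarrow> f y = g y"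
  shows "pd i f x = pd i g x"
proof -
  have "(f has_derivative f') (at x) \<longleftrightarrow> (g has_derivative f') (at x)" for f'
    using has_derivative_transform_within_open[of f f' x UNIV S g]
      has_derivative_transform_within_open[of g f' x UNIV S f] assms by auto
  then show ?thesis by (simp add: pd_def frechet_derivative_def)
qed

section \<open>Smooth functions, and functions with vanishing gradient\<close>

lemma smooth_on_differentiable: "smooth_on S f \<Longrightarrow> x \<in> S \<Longrightarrow> f differentiable (at x)"
  unfolding smooth_on_def using Ck_on.simps(2)[of 0 S f] by blast

lemma smooth_on_continuous_pd: "smooth_on S f \<Longrightarrow> continuous_on S (pd i f)"
  unfolding smooth_on_def using Ck_on.simps(2)[of 0 S f] by (auto simp del: One_nat_def)

lemma smooth_on_const: "smooth_on S (\<lambda>_. c)"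
proof -
  have "Ck_on k S (\<lambda>_. c)" for k
  proof (induction k arbitrary: c)
    case (Suc k)
    have "pd i (\<lambda>_. c) = (\<lambda>_. 0)" for i :: 'a by (simp add: pd_const fun_eq_iff)
    then show ?case using Suc by simp
  qed simp
  then show ?thesis by (simp add: smooth_on_def)
qed

text \<open>A linear map that vanishes on the standard basis is zero, so the whole Frechet
  derivative vanishes on a connected open set. Every first integral below is obtained this
  way.\<close>

lemma constant_on_connected_if_pd_zero:
  fixes f :: "real ^ 'n::finite \<Rightarrow> real"
  assumes "open U" "connected U"
    and "\<And>x. x \<in> U \<Longrightarrow> f differentiable (at x)"
    and "\<And>x i. x \<in> U \<Longrightarrow> pd i f x = 0"
  shows "\<exists>c. \<forall>x\<in>U. f x = c"
proof -
  have "(f has_derivative (\<lambda>_. 0)) (at x)" if "x \<in> U" for x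
  proof -
    have d: "(f has_derivative frechet_derivative f (at x)) (at x)"
      using assms(3)[OF that] by (rule differentiable_has_derivative)
    then have "linear (frechet_derivative f (at x))" by (rule has_derivative_linear)
    then have "frechet_derivative f (at x) = (\<lambda>_. 0)"
      using assms(4)[OF that]
      by (intro linear_eq_stdbasis)
        (auto simp: pd_def Basis_vec_def linear_iff)
    with d show ?thesis by simp
  qed
  moreover from this have "continuous_on U f"
    by (meson continuous_at_imp_continuous_on has_derivative_continuous)
  ultimately have "f constant_on U"
    by (intro has_derivative_zero_connected_constant_on[OF assms(2,1) finite.emptyI])
      (auto intro: has_derivative_at_withinI)
  then show ?thesis by (simp add: constant_on_def)
qed

section \<open>Pullback of functions along the projection to the half-plane\<close>

lemma rz_nth [simp]: "rz x $ 1 = x $ 3" "rz x $ 2 = x $ 4"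
  by (simp_all add: rz_def)

lemma bounded_linear_rz: "bounded_linear rz"
  by (intro linear_conv_bounded_linear[THEN iffD1] linearI) (simp_all add: vec_eq_iff forall_2)

lemma open_spacetime: "open U \<Longrightarrow> open (spacetime U)"
  unfolding spacetime_def
  using continuous_open_preimage[OF bounded_linear.continuous_on[OF bounded_linear_rz continuous_on_id], of UNIV U]
  by (simp add: vimage_def)

text \<open>Chain rule for a linear projection that kills the t and phi directions. \<open>F\<close>
  is compared with the pullback over \<open>U\<close> alone, since the components of a Killing
  tensor are prescribed only there.\<close>

lemma pd_rz:
  assumes "open U" "rz x \<in> U" "\<And>y. rz y \<in> U \<Longrightarrow> F y = f (rz y)" "f differentiable (at (rz x))"
  shows "pd 1 F x = 0" "pd 2 F x = 0" "pd 3 F x = pd 1 f (rz x)" "pd 4 F x = pd 2 f (rz x)"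
proof -
  define f' where "f' = frechet_derivative f (at (rz x))"
  have f': "(f has_derivative f') (at (rz x))"
    unfolding f'_def using assms(4) by (rule differentiable_has_derivative)
  have "((\<lambda>y. f (rz y)) has_derivative (\<lambda>h. f' (rz h))) (at x)"
    using has_derivative_compose[OF bounded_linear.has_derivative[OF bounded_linear_rz has_derivative_ident] f'] .
  from pd_has_derivative[OF this]
  have *: "pd i F x = f' (rz (axis i 1))" for i
    using pd_cong_open[OF open_spacetime[OF assms(1)], of x F "\<lambda>y. f (rz y)" i] assms(2,3)
    by (simp add: spacetime_def)
  have "rz (axis 1 1) = 0" "rz (axis 2 1) = 0" "rz (axis 3 1) = axis 1 1" "rz (axis 4 1) = axis 2 1"
    by (simp_all add: vec_eq_iff forall_2 axis_def)
  moreover have "f' 0 = 0" using has_derivative_linear[OF f'] by (rule linear_0)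
  moreover have "pd i f (rz x) = f' (axis i 1)" for i
    by (simp add: pd_def f'_def)
  ultimately show "pd 1 F x = 0" "pd 2 F x = 0" "pd 3 F x = pd 1 f (rz x)" "pd 4 F x = pd 2 f (rz x)"
    by (simp_all add: *)
qed

section \<open>Diagonal metrics\<close>

lemma matrix_inv_diagonal:
  fixes A :: "real ^ 'n::finite ^ 'n"
  assumes "\<And>i j. i \<noteq> j \<Longrightarrow> A $ i $ j = 0" "\<And>i. A $ i $ i \<noteq> 0"
  shows "matrix_inv A $ i $ j = (if i = j then 1 / A $ i $ i else 0)"
proof -
  define B :: "real ^ 'n ^ 'n" where "B = (\<chi> i j. if i = j then 1 / A $ i $ i else 0)"
  have "(\<Sum>k\<in>UNIV. A $ i $ k * B $ k $ j) = (\<Sum>k\<in>UNIV. if k = i then A $ i $ i * B $ i $ j else 0)"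
    "(\<Sum>k\<in>UNIV. B $ i $ k * A $ k $ j) = (\<Sum>k\<in>UNIV. if k = i then B $ i $ i * A $ i $ j else 0)" for i j
    by (rule sum.cong, simp, use assms(1) in \<open>force simp: B_def\<close>)+
  then have "(A ** B) $ i $ j = A $ i $ i * B $ i $ j" "(B ** A) $ i $ j = B $ i $ i * A $ i $ j" for i j
    by (simp_all add: matrix_matrix_mult_def)
  then have "A ** B = mat 1" "B ** A = mat 1"
    using assms by (auto simp: vec_eq_iff mat_def B_def)
  \<comment> \<open>\<open>matrix_inv\<close> chooses some two-sided inverse, so uniqueness of the
    inverse is needed as well.\<close>
  then have "matrix_inv A = B"
    unfolding matrix_inv_def
    by (intro some_equality) (auto, metis matrix_mul_assoc matrix_mul_lid matrix_mul_rid)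
  then show ?thesis by (simp add: B_def)
qed

lemma christoffel_diagonal:
  assumes "\<And>i j. i \<noteq> j \<Longrightarrow> g x $ i $ j = 0" "\<And>i. g x $ i $ i \<noteq> 0"
  shows "christoffel g x k i j =
    (pd i (\<lambda>y. g y $ j $ k) x + pd j (\<lambda>y. g y $ i $ k) x - pd k (\<lambda>y. g y $ i $ j) x) / (2 * g x $ k $ k)"
  using assms unfolding christoffel_def
  by (subst sum.remove[of _ k]) (auto simp: matrix_inv_diagonal intro!: sum.neutral)

lemma lower_axis_nth: "lower g (\<lambda>_. axis k 1) x $ m = g x $ m $ k"
  by (simp add: lower_def matrix_vector_mult_def axis_def if_distrib cong: if_cong)

text \<open>Contraction with the lowered field turns the Christoffel symbol into one of the first
  kind. Its term differentiated along \<open>k\<close> vanishes, and the rest is half the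
  symmetrised gradient of the lowered components, so the symmetrised covariant derivative
  cancels.\<close>

lemma killing_field_axis:
  assumes "\<And>x i j. x \<in> M \<Longrightarrow> i \<noteq> j \<Longrightarrow> g x $ i $ j = 0" "\<And>x i. x \<in> M \<Longrightarrow> g x $ i $ i \<noteq> 0"
    and "\<And>x i j. x \<in> M \<Longrightarrow> pd k (\<lambda>y. g y $ i $ j) x = 0"
  shows "killing_field g M (\<lambda>_. axis k 1)"
proof -
  have "nabla1 g (lower g (\<lambda>_. axis k 1)) x a b + nabla1 g (lower g (\<lambda>_. axis k 1)) x b a = 0"
    if x: "x \<in> M" for x a b
  proof -
    have "(\<Sum>l\<in>UNIV. christoffel g x l c d * g x $ l $ k) = christoffel g x k c d * g x $ k $ k" for c d
      by (subst sum.remove[of _ k]) (auto simp: assms(1)[OF x] intro!: sum.neutral)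
    moreover have "christoffel g x k c d * g x $ k $ k =
        (pd c (\<lambda>y. g y $ d $ k) x + pd d (\<lambda>y. g y $ c $ k) x) / 2" for c d
      using assms(2)[OF x, of k]
      by (simp add: christoffel_diagonal[of g x, OF assms(1,2)[OF x]] assms(3)[OF x])
    ultimately have "(\<Sum>l\<in>UNIV. christoffel g x l c d * g x $ l $ k) =
        (pd c (\<lambda>y. g y $ d $ k) x + pd d (\<lambda>y. g y $ c $ k) x) / 2" for c d
      by metis
    from this[of a b] this[of b a] show ?thesis by (simp add: nabla1_def lower_axis_nth)
  qed
  then show ?thesis by (simp add: killing_field_def smooth_on_const)
qed

text \<open>Symmetry of \<open>K\<close> and of the Christoffel symbols merges the six covariant
  derivatives into three partial derivatives, each counted twice, and three contractions, each
  counted four times. The remaining factor 2 cancels the 2 in the denominator of each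
  symbol.\<close>

lemma killing_tensor_diagonal:
  assumes K: "killing_tensor g M K" and M: "open M" "x \<in> M"
    and diag: "\<And>i j. i \<noteq> j \<Longrightarrow> g x $ i $ j = 0" "\<And>i. g x $ i $ i \<noteq> 0"
    and sym: "\<And>y i j. g y $ i $ j = g y $ j $ i"
  shows "pd a (\<lambda>y. K y $ m $ n) x + pd m (\<lambda>y. K y $ n $ a) x + pd n (\<lambda>y. K y $ a $ m) x =
    (\<Sum>l\<in>UNIV. ((pd a (\<lambda>y. g y $ m $ l) x + pd m (\<lambda>y. g y $ a $ l) x - pd l (\<lambda>y. g y $ a $ m) x) * K x $ l $ n
      + (pd m (\<lambda>y. g y $ n $ l) x + pd n (\<lambda>y. g y $ m $ l) x - pd l (\<lambda>y. g y $ m $ n) x) * K x $ l $ a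
      + (pd n (\<lambda>y. g y $ a $ l) x + pd a (\<lambda>y. g y $ n $ l) x - pd l (\<lambda>y. g y $ n $ a) x) * K x $ l $ m)
      / g x $ l $ l)"
proof -
  define C where "C l i j = christoffel g x l i j" for l i j
  have C: "C l i j = (pd i (\<lambda>y. g y $ j $ l) x + pd j (\<lambda>y. g y $ i $ l) x - pd l (\<lambda>y. g y $ i $ j) x)
      / (2 * g x $ l $ l)" for l i j
    unfolding C_def using diag by (rule christoffel_diagonal)
  have C_sym: "C l i j = C l j i" for l i j
    using sym[of _ i j] by (simp add: C add.commute)
  have K_sym: "K x $ i $ j = K x $ j $ i" for i j
    using K M by (simp add: killing_tensor_def)
  have pd_sym: "pd k (\<lambda>y. K y $ i $ j) x = pd k (\<lambda>y. K y $ j $ i) x" for i j k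
    using K M by (intro pd_cong_open[of M]) (simp_all add: killing_tensor_def)
  have N: "nabla2 g K x i j k = pd i (\<lambda>y. K y $ j $ k) x - (\<Sum>l\<in>UNIV. C l i j * K x $ l $ k)
      - (\<Sum>l\<in>UNIV. C l i k * K x $ l $ j)" for i j k
    using K_sym by (simp add: nabla2_def C_def)
  have "nabla2 g K x a m n + nabla2 g K x a n m + nabla2 g K x m a n
      + nabla2 g K x m n a + nabla2 g K x n a m + nabla2 g K x n m a = 0"
    using K M by (simp add: killing_tensor_def)
  then have "pd a (\<lambda>y. K y $ m $ n) x + pd m (\<lambda>y. K y $ n $ a) x + pd n (\<lambda>y. K y $ a $ m) x =
     2 * ((\<Sum>l\<in>UNIV. C l a m * K x $ l $ n) + (\<Sum>l\<in>UNIV. C l m n * K x $ l $ a) + (\<Sum>l\<in>UNIV. C l n a * K x $ l $ m))"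
    unfolding N pd_sym[of _ n m] pd_sym[of _ a n] pd_sym[of _ m a] C_sym[of _ m a] C_sym[of _ n m] C_sym[of _ a n]
    by simp
  also have "\<dots> = (\<Sum>l\<in>UNIV. 2 * (C l a m * K x $ l $ n + C l m n * K x $ l $ a + C l n a * K x $ l $ m))"
    by (simp add: sum.distrib sum_distrib_left)
  finally show ?thesis
    by (rule trans) (intro sum.cong refl, use diag(2) in \<open>simp add: C field_simps\<close>)
qed

text \<open>The conclusions are the index triples (3,i,i), (4,i,i), (3,3,3), (4,4,4), (3,1,2) and
  (4,1,2) of the Killing equation. Entries outside the block are zero as functions, so their
  derivatives drop out too.\<close>

lemma block_killing_equations:
  fixes G :: "4 \<Rightarrow> real ^ 2 \<Rightarrow> real" and L :: "4 \<Rightarrow> 4 \<Rightarrow> real ^ 2 \<Rightarrow> real"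
  assumes U: "open U" "p \<in> U"
    and g: "\<And>x i j. g x $ i $ j = (if i = j then G i (rz x) else 0)"
    and G: "\<And>i. G i differentiable (at p)" "\<And>i. G i p \<noteq> 0"
    and K: "killing_tensor g (spacetime U) K"
    and K_eq: "\<And>x i j. rz x \<in> U \<Longrightarrow> K x $ i $ j = L i j (rz x)"
    and L: "\<And>i j. L i j differentiable (at p)"
    and L_sym: "L 2 1 = L 1 2"
    and L_zero: "\<And>i j. i \<noteq> j \<Longrightarrow> {i, j} \<noteq> {1, 2} \<Longrightarrow> L i j = (\<lambda>_. 0)"
  shows "i \<noteq> 3 \<Longrightarrow> pd 1 (L i i) p = (2 * (L i i p / G i p) - L 3 3 p / G 3 p) * pd 1 (G i) p"
    and "i \<noteq> 4 \<Longrightarrow> pd 2 (L i i) p = (2 * (L i i p / G i p) - L 4 4 p / G 4 p) * pd 2 (G i) p"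
    and "pd 1 (L 3 3) p = L 3 3 p / G 3 p * pd 1 (G 3) p"
    and "pd 2 (L 4 4) p = L 4 4 p / G 4 p * pd 2 (G 4) p"
    and "pd j (L 1 2) p = L 1 2 p * (pd j (G 1) p / G 1 p + pd j (G 2) p / G 2 p)"
proof -
  \<comment> \<open>A point over \<open>p\<close>; t and phi may be chosen freely because all
    components factor through \<open>rz\<close>.\<close>
  define x :: "real ^ 4" where "x = vector [0, 0, p $ 1, p $ 2]"
  have x3: "x $ 3 = p $ 1" and x4: "x $ 4 = p $ 2"
    by (simp_all add: x_def vector_def numeral_eq_Suc)
  then have x: "rz x = p" by (simp add: vec_eq_iff forall_2)
  have xM: "x \<in> spacetime U" using x U by (simp add: spacetime_def)
  note pdK = pd_rz[OF U(1), of x "\<lambda>y. K y $ i $ j" "L i j" for i j, unfolded x, OF U(2) K_eq L]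
  have dg: "(if i = j then G i else (\<lambda>_. 0)) differentiable (at p)" for i j
    using G(1) by simp
  note pdg = pd_rz[OF U(1), of x "\<lambda>y. g y $ i $ j" "if i = j then G i else (\<lambda>_. 0)" for i j, unfolded x, OF U(2) _ dg]
  have pdg: "pd 1 (\<lambda>y. g y $ i $ j) x = 0" "pd 2 (\<lambda>y. g y $ i $ j) x = 0"
    "pd 3 (\<lambda>y. g y $ i $ j) x = (if i = j then pd 1 (G i) p else 0)"
    "pd 4 (\<lambda>y. g y $ i $ j) x = (if i = j then pd 2 (G i) p else 0)" for i j
    using pdg[of i j] by (simp_all add: g pd_const)
  have Kx: "K x $ i $ j = L i j p" for i j using K_eq[of x] U x by simp
  have gx: "g x $ i $ j = (if i = j then G i p else 0)" for i j by (simp add: g x)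
  have eq: "pd a (\<lambda>y. K y $ m $ n) x + pd m (\<lambda>y. K y $ n $ a) x + pd n (\<lambda>y. K y $ a $ m) x =
    (\<Sum>l\<in>UNIV. ((pd a (\<lambda>y. g y $ m $ l) x + pd m (\<lambda>y. g y $ a $ l) x - pd l (\<lambda>y. g y $ a $ m) x) * K x $ l $ n
      + (pd m (\<lambda>y. g y $ n $ l) x + pd n (\<lambda>y. g y $ m $ l) x - pd l (\<lambda>y. g y $ m $ n) x) * K x $ l $ a
      + (pd n (\<lambda>y. g y $ a $ l) x + pd a (\<lambda>y. g y $ n $ l) x - pd l (\<lambda>y. g y $ n $ a) x) * K x $ l $ m)
      / g x $ l $ l)" for a m n
    by (rule killing_tensor_diagonal[OF K open_spacetime[OF U(1)] xM]) (use G in \<open>auto simp: g x\<close>)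
  have L_zeros: "L 1 3 = (\<lambda>_. 0)" "L 1 4 = (\<lambda>_. 0)" "L 2 3 = (\<lambda>_. 0)" "L 2 4 = (\<lambda>_. 0)"
    "L 3 4 = (\<lambda>_. 0)" "L 3 1 = (\<lambda>_. 0)" "L 4 1 = (\<lambda>_. 0)" "L 3 2 = (\<lambda>_. 0)" "L 4 2 = (\<lambda>_. 0)"
    "L 4 3 = (\<lambda>_. 0)"
    by (intro L_zero; simp add: doubleton_eq_iff)+
  note simps = sum_4 pdg pdK Kx gx L_zeros L_sym pd_const
  have G0: "G 1 p \<noteq> 0" "G 2 p \<noteq> 0" "G 3 p \<noteq> 0" "G 4 p \<noteq> 0" using G(2) by auto
  show "i \<noteq> 3 \<Longrightarrow> pd 1 (L i i) p = (2 * (L i i p / G i p) - L 3 3 p / G 3 p) * pd 1 (G i) p"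
    using eq[of 3 i i] exhaust_4[of i] G0 by (auto simp: simps divide_inverse algebra_simps)
  show "i \<noteq> 4 \<Longrightarrow> pd 2 (L i i) p = (2 * (L i i p / G i p) - L 4 4 p / G 4 p) * pd 2 (G i) p"
    using eq[of 4 i i] exhaust_4[of i] G0 by (auto simp: simps divide_inverse algebra_simps)
  show "pd 1 (L 3 3) p = L 3 3 p / G 3 p * pd 1 (G 3) p"
    using eq[of 3 3 3] G0 by (simp add: simps divide_inverse algebra_simps)
  show "pd 2 (L 4 4) p = L 4 4 p / G 4 p * pd 2 (G 4) p"
    using eq[of 4 4 4] G0 by (simp add: simps divide_inverse algebra_simps)
  show "pd j (L 1 2) p = L 1 2 p * (pd j (G 1) p / G 1 p + pd j (G 2) p / G 2 p)"
    using eq[of 3 1 2] eq[of 4 1 2] exhaust_2[of j] G0 by (auto simp: simps divide_inverse algebra_simps)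
qed

section \<open>Weyl metrics\<close>

lemma weyl_metric_nth:
  "weyl_metric lam mu x $ i $ j = (if i = j then
     (if i = 1 then exp (2 * lam (rz x))
      else if i = 2 then - ((rz x $ 1)\<^sup>2 * exp (- (2 * lam (rz x))))
      else - exp (2 * mu (rz x) - 2 * lam (rz x))) else 0)"
proof -
  have "\<forall>i j. weyl_metric lam mu x $ i $ j = (if i = j then
     (if i = 1 then exp (2 * lam (rz x))
      else if i = 2 then - ((rz x $ 1)\<^sup>2 * exp (- (2 * lam (rz x))))
      else - exp (2 * mu (rz x) - 2 * lam (rz x))) else 0)"
    unfolding forall_4 weyl_metric_def tprod_def
    by (simp add: axis_def exp_diff exp_minus divide_simps)
  then show ?thesis by blast
qed

text \<open>\<open>theta4\<close> is the conjugate of \<open>theta3\<close>, so imaginary parts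
  cancel: the \<open>l2\<close> term is a multiple of drho^2 + dz^2 and the \<open>l3\<close> term
  of drho^2 - dz^2. The (t, phi) entry comes from the squares of \<open>theta1\<close> and
  \<open>theta2\<close>, hence its factor \<open>1 - q\<close>.\<close>

lemma canonical_form_nth:
  assumes "complexify A = canonical_form lam mu q l0 l1 l2 l3 x"
  defines "p \<equiv> rz x"
  shows "A $ i $ j =
    (if i = j then
      (if i = 1 then exp (2 * lam p) * (l0 p * (1 + q) / 2 + l1 p)
       else if i = 2 then (p $ 1)\<^sup>2 * exp (- (2 * lam p)) * (l0 p * (1 + q) / 2 - l1 p)
       else exp (2 * mu p - 2 * lam p) * (if i = 3 then l2 p + l3 p else l2 p - l3 p))
     else if {i, j} = {1, 2} then p $ 1 * l0 p * (1 - q) / 2 else 0)"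
proof -
  have e: "exp (2 * a) = exp a * exp a" "exp (- (2 * a)) = exp (- a) * exp (- a)"
    "exp (a - b) = exp a * exp (- b)" for a b :: real
    by (simp_all flip: exp_add)
  have e': "exp a * exp (- a) = 1" "exp a * (c * exp (- a)) = c" for a c :: real
    by (simp_all add: exp_minus)
  have s: "complex_of_real (sqrt 2) * complex_of_real (sqrt 2) = 2" "sqrt 2 * sqrt 2 = 2"
    by (simp_all flip: of_real_mult)
  have A: "A $ i $ j = Re (canonical_form lam mu q l0 l1 l2 l3 x $ i $ j)" for i j
    using assms(1)[symmetric] by (simp add: complexify_def)
  have "\<forall>i j. A $ i $ j =
    (if i = j then
      (if i = 1 then exp (2 * lam p) * (l0 p * (1 + q) / 2 + l1 p)
       else if i = 2 then (p $ 1)\<^sup>2 * exp (- (2 * lam p)) * (l0 p * (1 + q) / 2 - l1 p)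
       else exp (2 * mu p - 2 * lam p) * (if i = 3 then l2 p + l3 p else l2 p - l3 p))
     else if {i, j} = {1, 2} then p $ 1 * l0 p * (1 - q) / 2 else 0)"
    unfolding A forall_4 canonical_form_def Let_def tprod_def theta1_def theta2_def theta3_def theta4_def
    by (simp add: axis_def e s p_def doubleton_eq_iff power2_eq_square) (auto simp: algebra_simps e' s)
  then show ?thesis by blast
qed

text \<open>Each diagonal entry of \<open>K\<close> is, up to sign, a metric entry times a scalar;
  cancelling the metric entry leaves equations for the scalars. \<open>h\<close> is the logarithmic
  derivative of the phi phi entry of the metric, and \<open>D\<close> is the scalar of the direction
  of differentiation.\<close>

lemma canonical_killing_equations:
  assumes U: "open U" "p \<in> U" "p $ 1 > 0" and q: "q \<noteq> 1"
    and diff: "lam differentiable (at p)" "mu differentiable (at p)" "l0 differentiable (at p)"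
      "l1 differentiable (at p)" "l2 differentiable (at p)" "l3 differentiable (at p)"
    and K: "killing_tensor (weyl_metric lam mu) (spacetime U) K"
    and K_eq: "\<forall>x\<in>spacetime U. complexify (K x) = canonical_form lam mu q l0 l1 l2 l3 x"
  defines "h \<equiv> \<lambda>i::2. (if i = 1 then 2 / p $ 1 else 0) - 2 * pd i lam p"
    and "D \<equiv> \<lambda>i::2. if i = 1 then l2 p + l3 p else l2 p - l3 p"
  shows "pd i l3 p = 2 * (pd i mu p - pd i lam p) * l3 p"
    and "pd i l2 p = (if i = 1 then - pd i l3 p else pd i l3 p)"
    and "pd i l0 p = (if i = 1 then l0 p / p $ 1 else 0)"
    and "pd i l0 p * (1 + q) / 2 + pd i l1 p = 2 * pd i lam p * (l0 p * (1 + q) / 2 + l1 p + D i)"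
    and "pd i l1 p - pd i l0 p * (1 + q) / 2 = h i * (l1 p - l0 p * (1 + q) / 2 + D i)"
proof -
  \<comment> \<open>Squares are written as products so that \<open>pd_mult\<close> differentiates
    them.\<close>
  define G :: "4 \<Rightarrow> real ^ 2 \<Rightarrow> real" where "G i =
    (if i = 1 then (\<lambda>p. exp (2 * lam p))
     else if i = 2 then (\<lambda>p. - (p $ 1 * p $ 1 * exp (- (2 * lam p))))
     else (\<lambda>p. - exp (2 * mu p - 2 * lam p)))" for i
  define a b where "a = (1 + q) / 2" and "b = (1 - q) / 2"
  define L :: "4 \<Rightarrow> 4 \<Rightarrow> real ^ 2 \<Rightarrow> real" where "L i j =
    (if i = j then
      (if i = 1 then (\<lambda>p. exp (2 * lam p) * (l0 p * a + l1 p))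
       else if i = 2 then (\<lambda>p. p $ 1 * p $ 1 * exp (- (2 * lam p)) * (l0 p * a - l1 p))
       else if i = 3 then (\<lambda>p. exp (2 * mu p - 2 * lam p) * (l2 p + l3 p))
       else (\<lambda>p. exp (2 * mu p - 2 * lam p) * (l2 p - l3 p)))
     else if {i, j} = {1, 2} then (\<lambda>p. p $ 1 * l0 p * b) else (\<lambda>_. 0))" for i j
  note diffs = diff nth_differentiable exp_differentiable differentiable_add differentiable_diff
    differentiable_mult differentiable_minus differentiable_const
  note pds = pd_mult pd_add pd_diff pd_minus pd_exp pd_const pd_nth
  have g: "weyl_metric lam mu x $ i $ j = (if i = j then G i (rz x) else 0)" for x i j
    by (simp add: weyl_metric_nth G_def power2_eq_square)
  have dG: "G i differentiable (at p)" for i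
    by (simp add: G_def diffs)
  have G0: "G i p \<noteq> 0" for i using U(3) by (simp add: G_def)
  have KL: "K x $ i $ j = L i j (rz x)" if "rz x \<in> U" for x i j
    using K_eq that exhaust_4[of i]
    by (auto simp: spacetime_def canonical_form_nth L_def a_def b_def power2_eq_square)
  have dL: "L i j differentiable (at p)" for i j
    by (simp add: L_def diffs)
  have L_sym: "L 2 1 = L 1 2" by (simp add: L_def insert_commute)
  have L_zero: "L i j = (\<lambda>_. 0)" if "i \<noteq> j" "{i, j} \<noteq> {1, 2}" for i j
    using that by (simp add: L_def)
  note E = block_killing_equations[OF U(1,2) g dG G0 K KL dL L_sym L_zero]
  have pdG: "pd i (G 1) p = 2 * pd i lam p * G 1 p" "pd i (G 2) p = h i * G 2 p"
    "pd i (G 3) p = 2 * (pd i mu p - pd i lam p) * G 3 p"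
    "pd i (G 4) p = 2 * (pd i mu p - pd i lam p) * G 4 p" for i
    using U(3) by (simp_all add: G_def pds diffs h_def algebra_simps)
  define P where "P = l0 p * a"
  define P' where "P' i = pd i l0 p * a" for i
  have Lp: "L 1 1 p = G 1 p * (P + l1 p)" "L 2 2 p = G 2 p * (l1 p - P)"
    "L 3 3 p = - G 3 p * (l2 p + l3 p)" "L 4 4 p = - G 4 p * (l2 p - l3 p)"
    "L 1 2 p = p $ 1 * l0 p * b"
    by (simp_all add: L_def G_def P_def algebra_simps)
  have pdL: "pd i (L 1 1) p = pd i (G 1) p * (P + l1 p) + G 1 p * (P' i + pd i l1 p)"
    "pd i (L 2 2) p = pd i (G 2) p * (l1 p - P) + G 2 p * (pd i l1 p - P' i)"
    "pd i (L 3 3) p = - pd i (G 3) p * (l2 p + l3 p) - G 3 p * (pd i l2 p + pd i l3 p)"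
    "pd i (L 4 4) p = - pd i (G 4) p * (l2 p - l3 p) - G 4 p * (pd i l2 p - pd i l3 p)"
    "pd i (L 1 2) p = (p $ 1 * pd i l0 p + (if i = 1 then l0 p else 0)) * b" for i
    by (simp_all add: L_def G_def pds diffs P_def P'_def algebra_simps)
  have b: "b \<noteq> 0" using q by (simp add: b_def)
  have c: "a = b" if "G k p * a = G k p * b" for a b k using that G0 by simp
  have R: "L 1 1 p / G 1 p = P + l1 p" "L 2 2 p / G 2 p = l1 p - P"
    "L 3 3 p / G 3 p = - (l2 p + l3 p)" "L 4 4 p / G 4 p = - (l2 p - l3 p)"
    using G0 by (simp_all add: Lp)
  note E1 = E(1)[of 1] E(1)[of 2] E(1)[of 4]
  note E2 = E(2)[of 1] E(2)[of 2] E(2)[of 3]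
  have "P' i + pd i l1 p = 2 * pd i lam p * (P + l1 p + D i)" for i
    by (rule c[of 1], use E1(1) E2(1) exhaust_2[of i] G0 in
      \<open>auto simp: R pdL pdG D_def algebra_simps\<close>)
  then show "pd i l0 p * (1 + q) / 2 + pd i l1 p = 2 * pd i lam p * (l0 p * (1 + q) / 2 + l1 p + D i)"
    by (simp add: P_def P'_def a_def)
  have "pd i l1 p - P' i = h i * (l1 p - P + D i)" for i
    by (rule c[of 2], use E1(2) E2(2) exhaust_2[of i] G0 in
      \<open>auto simp: R pdL pdG D_def algebra_simps\<close>)
  then show "pd i l1 p - pd i l0 p * (1 + q) / 2 = h i * (l1 p - l0 p * (1 + q) / 2 + D i)"
    by (simp add: P_def P'_def a_def)
  \<comment> \<open>The (3,3,3) and (4,4,4) equations make \<open>l2 + l3\<close> stationary in rho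
    and \<open>l2 - l3\<close> stationary in z. The (3,4,4) and (4,3,3) equations below supply the
    other two derivatives.\<close>
  have D1: "pd 1 l2 p + pd 1 l3 p = 0"
    by (rule c[of 3], use E(3) G0 in \<open>simp add: R pdL pdG algebra_simps\<close>)
  have D2: "pd 2 l2 p - pd 2 l3 p = 0"
    by (rule c[of 4], use E(4) G0 in \<open>simp add: R pdL pdG algebra_simps\<close>)
  show "pd i l2 p = (if i = 1 then - pd i l3 p else pd i l3 p)"
    using D1 D2 exhaust_2[of i] by auto
  have "pd 1 l2 p - pd 1 l3 p = - 4 * (pd 1 mu p - pd 1 lam p) * l3 p"
    by (rule c[of 4], use E1(3) G0 in \<open>simp add: R pdL pdG algebra_simps\<close>)
  moreover have "pd 2 l2 p + pd 2 l3 p = 4 * (pd 2 mu p - pd 2 lam p) * l3 p"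
    by (rule c[of 3], use E2(3) G0 in \<open>simp add: R pdL pdG algebra_simps\<close>)
  ultimately show "pd i l3 p = 2 * (pd i mu p - pd i lam p) * l3 p"
    using D1 D2 exhaust_2[of i] by (auto simp: algebra_simps)
  \<comment> \<open>Since \<open>G 1 * G 2\<close> is minus rho squared, \<open>lam\<close> drops
    out of the sum of logarithmic derivatives. After division by the nonzero \<open>b\<close>,
    \<open>l0\<close> is proportional to rho.\<close>
  have "pd i (L 1 2) p = L 1 2 p * (2 * pd i lam p + h i)"
    using E(5)[of i] G0 by (simp add: pdG)
  then have "(p $ 1 * pd i l0 p + (if i = 1 then l0 p else 0)) * b =
      (if i = 1 then 2 * l0 p else 0) * b"
    using U(3) by (cases "i = 1") (simp_all add: Lp pdL h_def field_simps)
  then show "pd i l0 p = (if i = 1 then l0 p / p $ 1 else 0)"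
    using U(3) b by (auto simp: field_simps)
qed

section \<open>Pointwise alternative: \<open>l3\<close> vanishes or \<open>lam\<close> is stationary
  in z\<close>

lemma l3_mult_pd2_lam_eq_0:
  assumes vac: "weyl_vacuum U lam mu"
    and smooth: "smooth_on U l0" "smooth_on U l1" "smooth_on U l2" "smooth_on U l3"
    and l3: "\<And>p i. p \<in> U \<Longrightarrow> pd i l3 p = 2 * (pd i mu p - pd i lam p) * l3 p"
    and l2: "\<And>p i. p \<in> U \<Longrightarrow> pd i l2 p = (if i = 1 then - pd i l3 p else pd i l3 p)"
    and l0: "\<And>p i. p \<in> U \<Longrightarrow> pd i l0 p = (if i = 1 then l0 p / p $ 1 else 0)"
    and tt: "\<And>p i. p \<in> U \<Longrightarrow> pd i l0 p * a + pd i l1 p =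
        2 * pd i lam p * (l0 p * a + l1 p + (if i = 1 then l2 p + l3 p else l2 p - l3 p))"
    and pp: "\<And>p i. p \<in> U \<Longrightarrow> pd i l1 p - pd i l0 p * a =
        ((if i = 1 then 2 / p $ 1 else 0) - 2 * pd i lam p)
          * (l1 p - l0 p * a + (if i = 1 then l2 p + l3 p else l2 p - l3 p))"
    and p: "p \<in> U"
  shows "l3 p * pd 2 lam p = 0"
proof (rule ccontr)
  assume nz: "l3 p * pd 2 lam p \<noteq> 0"
  define N where "N = {y \<in> U. l3 y * pd 2 lam y \<noteq> 0}"
  have U: "open U" and smooth_lam: "smooth_on U lam" and r: "p $ 1 > 0"
    and mu1: "pd 1 mu p = p $ 1 * ((pd 1 lam p)\<^sup>2 - (pd 2 lam p)\<^sup>2)"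
    using vac p by (auto simp: weyl_vacuum_def)
  have diff: "l2 differentiable (at p)" "l3 differentiable (at p)"
    using smooth p by (auto intro: smooth_on_differentiable)
  have "continuous_on U (\<lambda>y. l3 y * pd 2 lam y)"
    using smooth_lam smooth(4) unfolding smooth_on_def
    by (intro continuous_on_mult smooth_on_continuous_pd[of U lam])
      (auto simp: smooth_on_def intro: Ck_on.simps(1)[THEN iffD1])
  then have "open N"
    unfolding N_def
    using continuous_open_preimage[OF _ U, of "\<lambda>y. l3 y * pd 2 lam y" "- {0}"] open_Compl[OF closed_singleton[of "0 :: real"]]
    by (simp add: Int_def vimage_def)
  moreover have "p \<in> N" using nz p by (simp add: N_def)
  \<comment> \<open>the identity holds on an open set, so it may be differentiated at \<open>p\<close>\<close>
  moreover have "l1 y = - (l2 y - l3 y)" if "y \<in> N" for y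
  proof -
    have y: "y \<in> U" "pd 2 lam y \<noteq> 0" using that by (auto simp: N_def)
    \<comment> \<open>As \<open>l0\<close> is stationary in z, the difference of the two z-equations
      loses both \<open>l0 * a\<close> and the derivative of \<open>l1\<close>.\<close>
    have "pd 2 lam y * (l1 y + l2 y - l3 y) = 0"
      using tt[OF y(1), of 2] pp[OF y(1), of 2] l0[OF y(1), of 2] by (simp add: algebra_simps)
    with y(2) show ?thesis by simp
  qed
  ultimately have "pd i l1 p = - (pd i l2 p - pd i l3 p)" "l1 p = - (l2 p - l3 p)" for i
    using pd_cong_open[of N p l1 "\<lambda>y. - (l2 y - l3 y)" i] diff
    by (simp_all add: pd_minus pd_diff)
  then have l1: "pd 1 l1 p = 4 * (pd 1 mu p - pd 1 lam p) * l3 p" "pd 2 l1 p = 0" "l1 p = l3 p - l2 p"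
    using l2[OF p] l3[OF p] by simp_all
  \<comment> \<open>With \<open>l1 = l3 - l2\<close> and \<open>l1\<close> stationary in z, the
    z-equation \<open>tt\<close> reduces to a nonzero multiple of \<open>l0 * a\<close>.\<close>
  have l0_p: "l0 p * a = 0"
    using tt[OF p, of 2] l0[OF p, of 2] l1 nz by simp
  then have pd_l0: "pd 1 l0 p * a = 0"
    using l0[OF p, of 1] by simp
  \<comment> \<open>Here \<open>l1 + l2 + l3\<close> equals \<open>2 * l3\<close>. Comparing these
    two values with the one in \<open>l1(1)\<close> determines the rho-derivatives of
    \<open>lam\<close> and \<open>mu\<close>.\<close>
  have "pd 1 l1 p = 4 * pd 1 lam p * l3 p" "pd 1 l1 p = 4 * (1 / p $ 1 - pd 1 lam p) * l3 p"
    using tt[OF p, of 1] pp[OF p, of 1] unfolding l0_p pd_l0 l1(3) by (simp_all add: algebra_simps)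
  then have "pd 1 mu p - pd 1 lam p = pd 1 lam p" "pd 1 lam p = 1 / p $ 1 - pd 1 lam p"
    using nz l1(1) by auto
  then have "p $ 1 * pd 1 lam p = 1 / 2" "p $ 1 * pd 1 mu p = 1"
    using r by (simp_all add: field_simps)
  moreover have "p $ 1 * pd 1 mu p = (p $ 1 * pd 1 lam p)\<^sup>2 - (p $ 1 * pd 2 lam p)\<^sup>2"
    by (simp add: mu1 power2_eq_square algebra_simps)
  \<comment> \<open>The vacuum equation times rho would make 1 equal to 1/4 minus a square.\<close>
  ultimately have "1 = (1 / 2 :: real)\<^sup>2 - (p $ 1 * pd 2 lam p)\<^sup>2"
    by metis
  then show False
    using zero_le_power2[of "p $ 1 * pd 2 lam p"] by (simp add: power_divide)
qed

text \<open>With these constants the entries of \<open>K\<close> plus \<open>d\<close> times the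
  metric are constant multiples of products of metric entries, the shape taken by products of
  lowered coordinate fields. Each constant is found by showing that a suitable function has zero
  gradient.\<close>

lemma canonical_constants:
  assumes vac: "weyl_vacuum U lam mu" and q: "q \<noteq> 1"
    and smooth: "smooth_on U l0" "smooth_on U l1" "smooth_on U l2" "smooth_on U l3"
    and K: "killing_tensor (weyl_metric lam mu) (spacetime U) K"
    and K_eq: "\<forall>x\<in>spacetime U. complexify (K x) = canonical_form lam mu q l0 l1 l2 l3 x"
  obtains c0 d c1 c2 c3 where
    "\<And>p. p \<in> U \<Longrightarrow> l0 p = c0 * p $ 1"
    "\<And>p. p \<in> U \<Longrightarrow> l0 p * (1 + q) / 2 + l1 p + d = c1 * exp (2 * lam p)"
    "\<And>p. p \<in> U \<Longrightarrow> l1 p - l0 p * (1 + q) / 2 + d = c2 * ((p $ 1)\<^sup>2 * exp (- (2 * lam p)))"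
    "\<And>p. p \<in> U \<Longrightarrow> l3 p = c3 * exp (2 * mu p - 2 * lam p)"
    "\<And>p. p \<in> U \<Longrightarrow> l2 p + l3 p = d"
    "c3 \<noteq> 0 \<Longrightarrow> \<forall>p\<in>U. pd 2 lam p = 0"
proof -
  have U: "open U" "connected U" and r: "\<And>p. p \<in> U \<Longrightarrow> p $ 1 > 0"
    and mu2: "\<And>p. p \<in> U \<Longrightarrow> pd 2 mu p = 2 * p $ 1 * pd 1 lam p * pd 2 lam p"
    using vac by (auto simp: weyl_vacuum_def)
  have diff: "lam differentiable (at p)" "mu differentiable (at p)" "l0 differentiable (at p)"
      "l1 differentiable (at p)" "l2 differentiable (at p)" "l3 differentiable (at p)" if "p \<in> U" for p
    using vac smooth that by (auto intro: smooth_on_differentiable simp: weyl_vacuum_def)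
  define a where "a = (1 + q) / 2"
  have l3: "pd i l3 p = 2 * (pd i mu p - pd i lam p) * l3 p"
    and l2: "pd i l2 p = (if i = 1 then - pd i l3 p else pd i l3 p)"
    and l0: "pd i l0 p = (if i = 1 then l0 p / p $ 1 else 0)"
    and tt: "pd i l0 p * a + pd i l1 p =
        2 * pd i lam p * (l0 p * a + l1 p + (if i = 1 then l2 p + l3 p else l2 p - l3 p))"
    and pp: "pd i l1 p - pd i l0 p * a =
        ((if i = 1 then 2 / p $ 1 else 0) - 2 * pd i lam p)
          * (l1 p - l0 p * a + (if i = 1 then l2 p + l3 p else l2 p - l3 p))"
    if p: "p \<in> U" for i p
    unfolding a_def times_divide_eq_right
    by (rule canonical_killing_equations[OF U(1) p r[OF p] q diff[OF p] K K_eq])+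
  have z: "l3 p = 0 \<or> pd 2 lam p = 0" if "p \<in> U" for p
    using l3_mult_pd2_lam_eq_0[OF vac smooth l3 l2 l0 tt pp that] by simp
  note diffs = diff nth_differentiable exp_differentiable differentiable_add differentiable_diff
    differentiable_mult differentiable_minus differentiable_const
  note pds = pd_mult pd_add pd_diff pd_minus pd_exp pd_const pd_nth pd_inverse
  note const = constant_on_connected_if_pd_zero[OF U]
  have inv: "(\<lambda>p. inverse (p $ 1)) differentiable (at p)" if "p \<in> U" for p :: "real ^ 2"
    using r[OF that] by (intro differentiable_inverse nth_differentiable) simp
  \<comment> \<open>Both z-derivatives in \<open>l3\<close> carry the factor
    \<open>pd 2 lam\<close>: for \<open>mu\<close> this is its vacuum equation.\<close>
  have z2: "pd 2 l3 p = 0" if "p \<in> U" for p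
    using z[OF that] l3[OF that, of 2] mu2[OF that] by auto
  have "\<exists>c. \<forall>p\<in>U. l2 p + l3 p = c"
  proof (rule const)
    show "pd i (\<lambda>p. l2 p + l3 p) p = 0" if "p \<in> U" for p i
      using that l2[of p i] z2[of p] exhaust_2[of i] by (auto simp: pds diffs)
  qed (simp add: diffs)
  then obtain d where d: "\<And>p. p \<in> U \<Longrightarrow> l2 p + l3 p = d"
    by blast
  have "\<exists>c. \<forall>p\<in>U. l0 p * inverse (p $ 1) = c"
  proof (rule const)
    show "pd i (\<lambda>p. l0 p * inverse (p $ 1)) p = 0" if "p \<in> U" for p i
      using that l0[of p i] r[of p] by (auto simp: pds diffs inv power2_eq_square divide_inverse)
  qed (simp add: diffs inv)
  then obtain c0 where c0: "\<And>p. p \<in> U \<Longrightarrow> l0 p * inverse (p $ 1) = c0"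
    by blast
  have "\<exists>c. \<forall>p\<in>U. (l0 p * a + l1 p + d) * exp (- (2 * lam p)) = c"
  proof (rule const)
    show "pd i (\<lambda>p. (l0 p * a + l1 p + d) * exp (- (2 * lam p))) p = 0" if "p \<in> U" for p i
    proof -
      have "pd i (\<lambda>p. (l0 p * a + l1 p + d) * exp (- (2 * lam p))) p =
          (pd i l0 p * a + pd i l1 p - 2 * pd i lam p * (l0 p * a + l1 p + d)) * exp (- (2 * lam p))"
        using that by (simp add: pds diffs algebra_simps)
      \<comment> \<open>For i = 2 the equation contains \<open>l2 - l3\<close> instead of
        \<open>d\<close>. By \<open>z\<close> the two agree because \<open>l3\<close> is 0, or their
        common factor \<open>pd 2 lam\<close> is 0.\<close>
      also have "pd i l0 p * a + pd i l1 p = 2 * pd i lam p * (l0 p * a + l1 p + d)"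
        using that tt[of p i] z[of p] d[of p] exhaust_2[of i] by auto
      finally show ?thesis by simp
    qed
  qed (simp add: diffs)
  then obtain c1 where c1: "\<And>p. p \<in> U \<Longrightarrow> (l0 p * a + l1 p + d) * exp (- (2 * lam p)) = c1"
    by blast
  have "\<exists>c. \<forall>p\<in>U. (l1 p - l0 p * a + d) * (inverse (p $ 1) * inverse (p $ 1) * exp (2 * lam p)) = c"
  proof (rule const)
    show "pd i (\<lambda>p. (l1 p - l0 p * a + d) * (inverse (p $ 1) * inverse (p $ 1) * exp (2 * lam p))) p = 0" if "p \<in> U" for p i
    proof -
      \<comment> \<open>\<open>w\<close> is the reciprocal of rho^2 exp(-2 lam), whose logarithmic
        derivative is \<open>h\<close>.\<close>
      define h where "h = (if i = 1 then 2 / p $ 1 else 0) - 2 * pd i lam p"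
      define w where "w p = inverse (p $ 1) * inverse (p $ 1) * exp (2 * lam p)" for p
      have w: "w differentiable (at p)" "pd i w p = - h * w p"
        unfolding w_def using that r[of p]
        by (auto simp: pds diffs inv h_def power2_eq_square divide_inverse algebra_simps)
      have "pd i (\<lambda>p. (l1 p - l0 p * a + d) * w p) p =
          (pd i l1 p - pd i l0 p * a - h * (l1 p - l0 p * a + d)) * w p"
        using that w by (simp add: pds diffs algebra_simps)
      also have "pd i l1 p - pd i l0 p * a = h * (l1 p - l0 p * a + d)"
        using that pp[of p i] z[of p] d[of p] exhaust_2[of i] by (auto simp: h_def)
      finally show ?thesis by (simp add: w_def)
    qed
  qed (simp add: diffs inv)
  then obtain c2 where c2: "\<And>p. p \<in> U \<Longrightarrow> (l1 p - l0 p * a + d) * (inverse (p $ 1) * inverse (p $ 1) * exp (2 * lam p)) = c2"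
    by blast
  have "\<exists>c. \<forall>p\<in>U. l3 p * exp (2 * lam p - 2 * mu p) = c"
  proof (rule const)
    show "pd i (\<lambda>p. l3 p * exp (2 * lam p - 2 * mu p)) p = 0" if "p \<in> U" for p i
    proof -
      have "pd i (\<lambda>p. l3 p * exp (2 * lam p - 2 * mu p)) p =
          (pd i l3 p - 2 * (pd i mu p - pd i lam p) * l3 p) * exp (2 * lam p - 2 * mu p)"
        using that by (simp add: pds diffs algebra_simps)
      then show ?thesis by (simp add: l3[OF that])
    qed
  qed (simp add: diffs)
  then obtain c3 where c3: "\<And>p. p \<in> U \<Longrightarrow> l3 p * exp (2 * lam p - 2 * mu p) = c3"
    by blast
  show ?thesis
  proof (rule that[of c0 d c1 c2 c3])
    fix p assume p: "p \<in> U"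
    show "l0 p = c0 * p $ 1"
      using c0[OF p] r[OF p] by (auto simp: field_simps)
    show "l0 p * (1 + q) / 2 + l1 p + d = c1 * exp (2 * lam p)"
      using c1[OF p] by (auto simp: a_def exp_minus field_simps)
    show "l1 p - l0 p * (1 + q) / 2 + d = c2 * ((p $ 1)\<^sup>2 * exp (- (2 * lam p)))"
      using c2[OF p] r[OF p] by (auto simp: a_def exp_minus power2_eq_square field_simps)
    show "l3 p = c3 * exp (2 * mu p - 2 * lam p)"
      using c3[OF p] by (auto simp: exp_diff)
    show "l2 p + l3 p = d" using d[OF p] .
  next
    \<comment> \<open>The exponential has no zeros, so \<open>l3\<close> vanishes everywhere or
      nowhere. This makes the pointwise alternative global.\<close>
    show "\<forall>p\<in>U. pd 2 lam p = 0" if "c3 \<noteq> 0"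
      using z c3 that by fastforce
  qed
qed

section \<open>Coordinate Killing fields and the decomposition of \<open>K\<close>\<close>

lemma weyl_killing_field_axis:
  assumes vac: "weyl_vacuum U lam mu"
    and k: "k \<in> {1, 2} \<or> k = 4 \<and> (\<forall>p\<in>U. pd 2 lam p = 0)"
  shows "killing_field (weyl_metric lam mu) (spacetime U) (\<lambda>_. axis k 1)"
proof (rule killing_field_axis)
  fix x :: "real ^ 4" and i j
  assume "x \<in> spacetime U"
  then have x: "rz x \<in> U" by (simp add: spacetime_def)
  have U: "open U" and r: "x $ 3 > 0"
    and mu2: "\<And>p. p \<in> U \<Longrightarrow> pd 2 mu p = 2 * p $ 1 * pd 1 lam p * pd 2 lam p"
    using vac x by (auto simp: weyl_vacuum_def)
  show "i \<noteq> j \<Longrightarrow> weyl_metric lam mu x $ i $ j = 0" "weyl_metric lam mu x $ i $ i \<noteq> 0"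
    using r by (auto simp: weyl_metric_nth)
  have diff: "lam differentiable (at (rz x))" "mu differentiable (at (rz x))"
    using vac x by (auto intro: smooth_on_differentiable simp: weyl_vacuum_def)
  define f where "f = (if i = j then
     (if i = 1 then (\<lambda>p. exp (2 * lam p))
      else if i = 2 then (\<lambda>p. - (p $ 1 * p $ 1 * exp (- (2 * lam p))))
      else (\<lambda>p. - exp (2 * mu p - 2 * lam p))) else (\<lambda>_. 0))"
  note diffs = diff nth_differentiable exp_differentiable differentiable_add differentiable_diff
    differentiable_mult differentiable_minus differentiable_const
  note pds = pd_mult pd_add pd_diff pd_minus pd_exp pd_const pd_nth
  have "f differentiable (at (rz x))" by (simp add: f_def diffs)
  then have "pd 1 (\<lambda>y. weyl_metric lam mu y $ i $ j) x = 0"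
    "pd 2 (\<lambda>y. weyl_metric lam mu y $ i $ j) x = 0"
    "pd 4 (\<lambda>y. weyl_metric lam mu y $ i $ j) x = pd 2 f (rz x)"
    using pd_rz[OF U x, of "\<lambda>y. weyl_metric lam mu y $ i $ j" f]
    by (simp_all add: weyl_metric_nth f_def power2_eq_square)
  \<comment> \<open>The vacuum equation passes the vanishing z-derivative from \<open>lam\<close> to
    \<open>mu\<close>.\<close>
  moreover have "pd 2 f (rz x) = 0" if "\<forall>p\<in>U. pd 2 lam p = 0"
    using that mu2[OF x] x by (simp add: f_def pds diffs)
  ultimately show "pd k (\<lambda>y. weyl_metric lam mu y $ i $ j) x = 0"
    using k by auto
qed

theorem mainTheorem2:
  fixes U :: "(real ^ 2) set"
    and lam mu l0 l1 l2 l3 :: "real ^ 2 \<Rightarrow> real"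
    and q :: real
    and K :: "real ^ 4 \<Rightarrow> real ^ 4 ^ 4"
  assumes "weyl_vacuum U lam mu"
    and "q \<in> {0, -1}"
    and "smooth_on U l0" "smooth_on U l1" "smooth_on U l2" "smooth_on U l3"
    and "killing_tensor (weyl_metric lam mu) (spacetime U) K"
    and "\<forall>x\<in>spacetime U. complexify (K x) = canonical_form lam mu q l0 l1 l2 l3 x"
  shows "reducible (weyl_metric lam mu) (spacetime U) K"
proof -
  let ?g = "weyl_metric lam mu"
  \<comment> \<open>Both values of \<open>q\<close> keep the factor \<open>1 - q\<close> of the (t,
    phi) entry nonzero.\<close>
  have q: "q \<noteq> 1" using assms(2) by auto
  obtain c0 d c1 c2 c3 where c0: "\<And>p. p \<in> U \<Longrightarrow> l0 p = c0 * p $ 1"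
    and c1: "\<And>p. p \<in> U \<Longrightarrow> l0 p * (1 + q) / 2 + l1 p + d = c1 * exp (2 * lam p)"
    and c2: "\<And>p. p \<in> U \<Longrightarrow> l1 p - l0 p * (1 + q) / 2 + d = c2 * ((p $ 1)\<^sup>2 * exp (- (2 * lam p)))"
    and c3: "\<And>p. p \<in> U \<Longrightarrow> l3 p = c3 * exp (2 * mu p - 2 * lam p)"
    and d: "\<And>p. p \<in> U \<Longrightarrow> l2 p + l3 p = d"
    and lam2: "c3 \<noteq> 0 \<Longrightarrow> \<forall>p\<in>U. pd 2 lam p = 0"
  proof (rule canonical_constants[OF assms(1) q assms(3-8)])
  qed (rule that)
  \<comment> \<open>if \<open>c3 = 0\<close> then \<open>dz\<close> need not be Killing; its coefficient vanishes and \<open>dt\<close> takes its place\<close>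
  define \<xi> :: "nat \<Rightarrow> 4 vfield" where
    "\<xi> k = (\<lambda>_. axis (if k < 2 then 1 else if k = 2 then 2 else if c3 = 0 then 1 else 4) 1)" for k
  define \<eta> :: "nat \<Rightarrow> 4 vfield" where "\<eta> k = (if k = 1 then (\<lambda>_. dphi) else \<xi> k)" for k
  define m where "m = c0 * (1 - q) / 2"
  \<comment> \<open>The products are, in order, t t, t phi, phi phi and z z. Lowering the phi field
    gives \<open>- f\<close> times dphi and the mixed symmetric product carries 1/2, hence
    \<open>- 2 * m\<close>.\<close>
  define c where "c k = [c1, - 2 * m, - c2, - 2 * c3] ! k" for k
  have "killing_field ?g (spacetime U) (\<xi> k)" for k
    unfolding \<xi>_def by (rule weyl_killing_field_axis[OF assms(1)]) (use lam2 in auto)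
  then have "killing_field ?g (spacetime U) (\<xi> k) \<and> killing_field ?g (spacetime U) (\<eta> k)" for k
    by (simp add: \<eta>_def weyl_killing_field_axis[OF assms(1)])
  moreover have "K x = (- d) *\<^sub>R ?g x + (\<Sum>k<4. c k *\<^sub>R sym_prod ?g (\<xi> k) (\<eta> k) x)"
    if x: "x \<in> spacetime U" for x
  proof -
    define p where "p = rz x"
    have p: "p \<in> U" using x by (simp add: spacetime_def p_def)
    define P e f where "P = l0 p * (1 + q) / 2" and "e = exp (2 * lam p)"
      and "f = (p $ 1)\<^sup>2 * exp (- (2 * lam p))"
    define F where "F = exp (2 * mu p - 2 * lam p)"
    \<comment> \<open>This identity turns the mixed entry, proportional to rho squared, into a
      constant times \<open>e * f\<close>.\<close>
    have ef: "e * f = (p $ 1)\<^sup>2" by (simp add: e_def f_def exp_minus)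
    have l1: "P + l1 p = c1 * e - d" "P - l1 p = d - c2 * f"
      using c1[OF p] c2[OF p] by (simp_all add: P_def e_def f_def)
    have l23: "l2 p + l3 p = d" "l2 p - l3 p = d - 2 * c3 * F"
      using c3[OF p] d[OF p] by (simp_all add: F_def)
    have g: "?g x $ i $ j = (if i = j then if i = 1 then e else if i = 2 then - f else - F else 0)" for i j
      by (simp add: weyl_metric_nth e_def f_def F_def p_def)
    have K: "K x $ i $ j = (if i = j then
        (if i = 1 then e * (P + l1 p) else if i = 2 then f * (P - l1 p)
         else F * (if i = 3 then l2 p + l3 p else l2 p - l3 p))
       else if {i, j} = {1, 2} then p $ 1 * l0 p * (1 - q) / 2 else 0)" for i j
      using canonical_form_nth[of "K x"] assms(8) x
      by (simp add: e_def f_def F_def p_def P_def)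
    have K12: "p $ 1 * l0 p * (1 - q) / 2 = m * (e * f)"
      using c0[OF p] by (simp add: ef m_def power2_eq_square)
    have K: "K x $ i $ j = (if i = j then
        (if i = 1 then e * (c1 * e - d) else if i = 2 then f * (d - c2 * f)
         else F * (if i = 3 then d else d - 2 * c3 * F))
       else if {i, j} = {1, 2} then m * (e * f) else 0)" for i j
      unfolding K K12 l1 l23 ..
    show ?thesis
      unfolding vec_eq_iff forall_4
      by (simp add: K g sym_prod_def tprod_def lower_axis_nth \<xi>_def \<eta>_def c_def eval_nat_numeral
          doubleton_eq_iff algebra_simps)
  qed
  ultimately show ?thesis unfolding reducible_def by blast
qed

end
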